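(* Let $X,Y$ be sets with equivalence relations $R_X,R_Y$, and let $K:X\to\mathcal{D}(Y)$ be an $(R_X,R_Y)$-compatible kernel. Then for all $\mu,\nu\in\mathcal{D}(X)$, $$d_{R_Y}(K^{\dagger}\mu,K^{\dagger}\nu)\le d_{R_X}(\mu,\nu).$$
   Context: For a set $X$, $\mathcal{D}(X)$ denotes the set of finitely supported probability distributions on $X$. A kernel from $X$ to $Y$ is a function $K:X\to\mathcal{D}(Y)$; its affine extension is $K^{\dagger}(\mu)(y)=\sum_x\mu(x)K(x)(y)$. For an equivalence relation $R_X$ on $X$ with quotient map $q_X:X\to X/R_X$, the quotient total-variation distance is $d_{R_X}(\mu,\nu)=\mathrm{TV}((q_X)_{\#}\mu,(q_X)_{\#}\nu)$, where $(q_X)_{\#}$ is pushforward and $\mathrm{TV}(\alpha,\beta)=\tfrac12\sum_u|\alpha(u)-\beta(u)|$. A kernel $K:X\to\mathcal{D}(Y)$ is $(R_X,R_Y)$-compatible when $x\,R_X\,x'$ implies $K(x)(E)=K(x')(E)$ for every class $E\in Y/R_Y$. *)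

theory Defs
  imports "HOL-Probability.Probability"
begin

definition fin_dists :: "'a set \<Rightarrow> 'a pmf set" where
  "fin_dists X = {\<mu>. finite (set_pmf \<mu>) \<and> set_pmf \<mu> \<subseteq> X}"

text \<open>A kernel is represented by a function on the whole type; its values outside the
  carrier \<open>X\<close> are unconstrained and irrelevant.\<close>

definition fin_kernel :: "'a set \<Rightarrow> 'b set \<Rightarrow> ('a \<Rightarrow> 'b pmf) \<Rightarrow> bool" where
  "fin_kernel X Y K \<longleftrightarrow> K \<in> X \<rightarrow> fin_dists Y"

definition affine_ext :: "('a \<Rightarrow> 'b pmf) \<Rightarrow> 'a pmf \<Rightarrow> 'b pmf" where
  "affine_ext K \<mu> = bind_pmf \<mu> K"

lemma pmf_affine_ext:
  assumes "finite (set_pmf \<mu>)"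
  shows "pmf (affine_ext K \<mu>) y = (\<Sum>x\<in>set_pmf \<mu>. pmf \<mu> x * pmf (K x) y)"
  unfolding affine_ext_def pmf_bind
  by (subst integral_measure_pmf[OF assms]) auto

lemma affine_ext_in_fin_dists:
  assumes "fin_kernel X Y K" and "\<mu> \<in> fin_dists X"
  shows "affine_ext K \<mu> \<in> fin_dists Y"
  using assms by (fastforce simp: affine_ext_def fin_kernel_def fin_dists_def)

text \<open>The sum is taken over the whole type; for finitely supported arguments only finitely
  many terms are nonzero.\<close>

definition tv_dist :: "'a pmf \<Rightarrow> 'a pmf \<Rightarrow> real" where
  "tv_dist \<alpha> \<beta> = (1/2) * (\<Sum>\<^sub>\<infinity>u. \<bar>pmf \<alpha> u - pmf \<beta> u\<bar>)"

lemma tv_dist_finite: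
  assumes "finite (set_pmf \<alpha>)" and "finite (set_pmf \<beta>)"
  shows "tv_dist \<alpha> \<beta> = (1/2) * (\<Sum>u\<in>set_pmf \<alpha> \<union> set_pmf \<beta>. \<bar>pmf \<alpha> u - pmf \<beta> u\<bar>)"
proof -
  have "(\<Sum>\<^sub>\<infinity>u. \<bar>pmf \<alpha> u - pmf \<beta> u\<bar>)
      = (\<Sum>\<^sub>\<infinity>u\<in>set_pmf \<alpha> \<union> set_pmf \<beta>. \<bar>pmf \<alpha> u - pmf \<beta> u\<bar>)"
    by (rule infsum_cong_neutral) (auto simp: set_pmf_iff)
  then show ?thesis
    using assms by (simp add: tv_dist_def)
qed

text \<open>For \<open>\<mu>\<close> supported in \<open>X\<close> the pushforward along \<open>x \<mapsto> R `` {x}\<close> is supported in the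
  quotient \<open>X // R\<close>.\<close>

definition quotient_tv :: "('a \<times> 'a) set \<Rightarrow> 'a pmf \<Rightarrow> 'a pmf \<Rightarrow> real" where
  "quotient_tv R \<mu> \<nu> = tv_dist (map_pmf (\<lambda>x. R `` {x}) \<mu>) (map_pmf (\<lambda>x. R `` {x}) \<nu>)"

lemma map_class_in_fin_dists:
  assumes "\<mu> \<in> fin_dists X"
  shows "map_pmf (\<lambda>x. R `` {x}) \<mu> \<in> fin_dists (X // R)"
  using assms by (auto simp: fin_dists_def intro: quotientI)

definition compatible_kernel ::
    "('a \<times> 'a) set \<Rightarrow> 'b set \<Rightarrow> ('b \<times> 'b) set \<Rightarrow> ('a \<Rightarrow> 'b pmf) \<Rightarrow> bool" where
  "compatible_kernel RX Y RY K \<longleftrightarrow>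
     (\<forall>x x'. (x, x') \<in> RX \<longrightarrow>
       (\<forall>E \<in> Y // RY. measure_pmf.prob (K x) E = measure_pmf.prob (K x') E))"

end

(* By compatibility, the class distribution of K x depends only on the class of x, so K descends
   to a kernel L between the quotients, and pushing K\<^sup>\<dagger>\<mu> to Y/RY gives L\<^sup>\<dagger> of the pushforward of \<mu> to
   X/RX. The claim is then the data processing inequality for total variation, applied to L. *)
theory Submission
  imports Defs
begin

lemma sum_pmf_le_1: "finite A \<Longrightarrow> (\<Sum>x\<in>A. pmf p x) \<le> 1"
  by (metis measure_measure_pmf_finite measure_pmf.prob_le_1)

text \<open>Summing over any finite superset \<open>S\<close> of the support lets two distributions
  share one index set, so their difference can be taken termwise.\<close>

lemma pmf_bind_sum:
  assumes "finite S" "set_pmf p \<subseteq> S"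
  shows "pmf (bind_pmf p L) y = (\<Sum>x\<in>S. pmf p x * pmf (L x) y)"
  unfolding pmf_bind
  by (subst integral_measure_pmf[OF assms(1)]) (use assms in auto)

text \<open>Data processing: the triangle inequality moves the absolute value inside the sum over
  \<open>x\<close>, and after exchanging the sums each \<open>L x\<close> contributes mass at most
  1. Finiteness of \<open>L x\<close> is asked only on the two supports, since a kernel is
  unconstrained off its carrier.\<close>

lemma tv_dist_bind_le:
  fixes L :: "'a \<Rightarrow> 'b pmf"
  assumes "finite (set_pmf \<alpha>)" "finite (set_pmf \<beta>)"
    and "\<And>x. x \<in> set_pmf \<alpha> \<union> set_pmf \<beta> \<Longrightarrow> finite (set_pmf (L x))"
  shows "tv_dist (bind_pmf \<alpha> L) (bind_pmf \<beta> L) \<le> tv_dist \<alpha> \<beta>"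
proof -
  define S where "S = set_pmf \<alpha> \<union> set_pmf \<beta>"
  define T where "T = set_pmf (bind_pmf \<alpha> L) \<union> set_pmf (bind_pmf \<beta> L)"
  have S: "finite S" "set_pmf \<alpha> \<subseteq> S" "set_pmf \<beta> \<subseteq> S"
    using assms by (auto simp: S_def)
  have fin: "finite (set_pmf (bind_pmf \<alpha> L))" "finite (set_pmf (bind_pmf \<beta> L))"
    using assms by auto
  then have T: "finite T"
    by (simp add: T_def)
  have "(\<Sum>u\<in>T. \<bar>pmf (bind_pmf \<alpha> L) u - pmf (bind_pmf \<beta> L) u\<bar>)
      = (\<Sum>u\<in>T. \<bar>\<Sum>x\<in>S. (pmf \<alpha> x - pmf \<beta> x) * pmf (L x) u\<bar>)"
    using S by (simp add: pmf_bind_sum[of S] sum_subtractf left_diff_distrib)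
  also have "\<dots> \<le> (\<Sum>u\<in>T. \<Sum>x\<in>S. \<bar>pmf \<alpha> x - pmf \<beta> x\<bar> * pmf (L x) u)"
    by (intro sum_mono order_trans[OF sum_abs]) (simp add: abs_mult)
  also have "\<dots> = (\<Sum>x\<in>S. \<bar>pmf \<alpha> x - pmf \<beta> x\<bar> * (\<Sum>u\<in>T. pmf (L x) u))"
    by (subst sum.swap) (simp add: sum_distrib_left)
  also have "\<dots> \<le> (\<Sum>x\<in>S. \<bar>pmf \<alpha> x - pmf \<beta> x\<bar>)"
    by (intro sum_mono mult_right_le_one_le sum_pmf_le_1 T sum_nonneg) auto
  finally show ?thesis
    using assms fin by (simp add: tv_dist_finite S_def T_def)
qed

text \<open>Turns the pushforward's mass at the point \<open>E\<close> into the probability of the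
  set \<open>E\<close>, the quantity that compatibility controls.\<close>

lemma class_vimage:
  assumes "equiv Y R" "E \<in> Y // R"
  shows "(\<lambda>y. R `` {y}) -` {E} = E"
proof (intro equalityI subsetI)
  fix y assume "y \<in> (\<lambda>y. R `` {y}) -` {E}"
  then have E: "E = R `` {y}" by simp
  then obtain z where "(y, z) \<in> R"
    using in_quotient_imp_non_empty[OF assms] by auto
  then have "y \<in> Y"
    using equiv_type[OF assms(1)] by auto
  then show "y \<in> E"
    using E equiv_class_self[OF assms(1)] by simp
next
  fix y assume "y \<in> E"
  then show "y \<in> (\<lambda>y. R `` {y}) -` {E}"
    using assms by (auto elim!: quotientE dest: equiv_class_eq)
qed

text \<open>At a class in \<open>Y // RY\<close> this is compatibility; at any other set both sides
  vanish, because \<open>K x\<close> and \<open>K x'\<close> are supported in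
  \<open>Y\<close>.\<close>

lemma compatible_map_class_eq:
  assumes "equiv X RX" "equiv Y RY" "fin_kernel X Y K" "compatible_kernel RX Y RY K"
    and "(x, x') \<in> RX"
  shows "map_pmf (\<lambda>y. RY `` {y}) (K x) = map_pmf (\<lambda>y. RY `` {y}) (K x')"
proof (rule pmf_eqI)
  fix E
  have "x \<in> X" "x' \<in> X"
    using equiv_type[OF assms(1)] assms(5) by auto
  then have K: "K x \<in> fin_dists Y" "K x' \<in> fin_dists Y"
    using assms(3) by (auto simp: fin_kernel_def)
  show "pmf (map_pmf (\<lambda>y. RY `` {y}) (K x)) E = pmf (map_pmf (\<lambda>y. RY `` {y}) (K x')) E"
  proof (cases "E \<in> Y // RY")
    case True
    then show ?thesis
      using assms(4,5) by (simp add: pmf_map class_vimage[OF assms(2)] compatible_kernel_def)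
  next
    case False
    then have "E \<notin> set_pmf (map_pmf (\<lambda>y. RY `` {y}) (K z))" if "K z \<in> fin_dists Y" for z
      using map_class_in_fin_dists[OF that, of RY] by (auto simp: fin_dists_def)
    with K show ?thesis
      by (metis set_pmf_iff)
  qed
qed

theorem theorem6:
  fixes X :: "'a set" and Y :: "'b set"
    and RX :: "('a \<times> 'a) set" and RY :: "('b \<times> 'b) set"
    and K :: "'a \<Rightarrow> 'b pmf"
  assumes "equiv X RX" and "equiv Y RY"
    and "fin_kernel X Y K"
    and "compatible_kernel RX Y RY K"
  shows "\<forall>\<mu> \<in> fin_dists X. \<forall>\<nu> \<in> fin_dists X.
    quotient_tv RY (affine_ext K \<mu>) (affine_ext K \<nu>) \<le> quotient_tv RX \<mu> \<nu>"
proof (intro ballI)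
  fix \<mu> \<nu> assume dists: "\<mu> \<in> fin_dists X" "\<nu> \<in> fin_dists X"
  \<comment> \<open>The descended kernel evaluates \<open>K\<close> at a chosen representative of
    the class; the next fact shows that the choice does not matter.\<close>
  define L where "L C = map_pmf (\<lambda>y. RY `` {y}) (K (SOME x. x \<in> C))" for C
  have L: "L (RX `` {x}) = map_pmf (\<lambda>y. RY `` {y}) (K x)" if "x \<in> X" for x
  proof -
    have "(x, SOME z. z \<in> RX `` {x}) \<in> RX"
      using someI[of "\<lambda>z. z \<in> RX `` {x}" x] equiv_class_self[OF assms(1) that] by simp
    from compatible_map_class_eq[OF assms this] show ?thesis
      by (simp add: L_def)
  qed
  \<comment> \<open>Both sides need to agree only on the support of \<open>\<rho>\<close>, which
    lies in \<open>X\<close>, where \<open>L\<close> is known.\<close>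
  have push: "map_pmf (\<lambda>y. RY `` {y}) (affine_ext K \<rho>) = bind_pmf (map_pmf (\<lambda>x. RX `` {x}) \<rho>) L"
    if "\<rho> \<in> fin_dists X" for \<rho>
    using that L
    by (auto simp: affine_ext_def map_bind_pmf bind_map_pmf fin_dists_def intro!: bind_pmf_cong)
  have "finite (set_pmf (K x))" if "x \<in> X" for x
    using assms(3) that by (auto simp: fin_kernel_def fin_dists_def)
  \<comment> \<open>Every such \<open>C\<close> is the class of a point \<open>x\<close> of
    \<open>X\<close>, so \<open>L C\<close> is an image of the finitely supported
    \<open>K x\<close>.\<close>
  then have "finite (set_pmf (L C))"
    if "C \<in> set_pmf (map_pmf (\<lambda>x. RX `` {x}) \<mu>) \<union> set_pmf (map_pmf (\<lambda>x. RX `` {x}) \<nu>)" for C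
    using that dists by (auto simp: fin_dists_def L subset_iff)
  then show "quotient_tv RY (affine_ext K \<mu>) (affine_ext K \<nu>) \<le> quotient_tv RX \<mu> \<nu>"
    using dists unfolding quotient_tv_def push[OF dists(1)] push[OF dists(2)]
    by (intro tv_dist_bind_le) (auto simp: fin_dists_def)
qed

end
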